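(* Let $d\ge2$, $N\ge1$, let the inverse temperature $\beta>0$ be finite, and let $i\neq j$ be levels of the system with $E_i<E_j$. Let $\mathbf p$ be a probability vector on $d$ levels and let $\mathcal P^{(ij)}$ be the memory-assisted protocol defined in the context, using an $N$-dimensional memory with trivial Hamiltonian. Then $$\mathcal P^{(ij)}(\mathbf p\otimes\boldsymbol\eta_M)=\mathbf q\otimes\boldsymbol\eta_M$$ with $$\delta\big(\mathbf q,\Pi^{\beta}_{ij}\mathbf p\big)=\frac{(4\Gamma_i\Gamma_j)^N}{(\Gamma_i-\Gamma_j)^2}\left[\frac{|p_i\Gamma_j-p_j\Gamma_i|}{(N+1)\sqrt{\pi N}}+o\big(N^{-3/2}\big)\right],$$ where $\Gamma_i=\gamma_i/(\gamma_i+\gamma_j)$ and $\Gamma_j=\gamma_j/(\gamma_i+\gamma_j)$.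
   Context: Setting: a $d$-level system with energies $E_1,\dots,E_d$ and thermal distribution $\gamma_a=e^{-\beta E_a}/\sum_b e^{-\beta E_b}$; an $N$-dimensional memory with trivial Hamiltonian and thermal state $\boldsymbol\eta_M=(1/N,\dots,1/N)$. Joint states are probability vectors $\mathbf Q$ of length $dN$, entry $(a-1)N+k$ corresponding to system level $a$ and memory level $k$; joint thermal distribution $\Gamma_{(a-1)N+k}=\gamma_a/N$. Two-level thermalisation $T_{xy}$: $Q_x\mapsto (Q_x+Q_y)\Gamma_x/(\Gamma_x+\Gamma_y)$, $Q_y\mapsto (Q_x+Q_y)\Gamma_y/(\Gamma_x+\Gamma_y)$, other entries unchanged. Round $\mathcal R^{(ij)}_k$ ($k=1,\dots,N$): apply sequentially, for $l=1,\dots,N$, $T_{(j-1)N+k,\,(i-1)N+l}$. $\widetilde{\mathcal P}^{(ij)}=\mathcal R^{(ij)}_N\circ\cdots\circ\mathcal R^{(ij)}_1$. Memory thermalisation $\mathcal T(\mathbf Q)=\mathbf q\otimes\boldsymbol\eta_M$, $q_a=\sum_kQ_{(a-1)N+k}$. $\mathcal P^{(ij)}=\mathcal T\circ\widetilde{\mathcal P}^{(ij)}$. $\beta$-swap $\Pi^\beta_{ij}$ (for $E_i\le E_j$): the stochastic matrix acting as $p_i\mapsto(1-e^{-\beta(E_j-E_i)})p_i+p_j$, $p_j\mapsto e^{-\beta(E_j-E_i)}p_i$, and identity on all other levels. Total variation distance: $\delta(\mathbf p,\mathbf q)=\frac12\sum_a|p_a-q_a|$. *)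

theory Defs
  imports Complex_Main "HOL-Library.Landau_Symbols"
begin

text \<open>Conventions: system levels are 0-based, a \<in> {0..<d}; memory levels k \<in> {0..<N};
  joint entry a*N + k corresponds to system level a and memory level k
  (the paper's (a-1)N+k with 1-based a, k).  Vectors are functions nat \<Rightarrow> real.\<close>

definition prob_vec :: "nat \<Rightarrow> (nat \<Rightarrow> real) \<Rightarrow> bool" where
  "prob_vec d p \<longleftrightarrow> (\<forall>a<d. 0 \<le> p a) \<and> (\<Sum>a<d. p a) = 1"

definition gibbs :: "nat \<Rightarrow> (nat \<Rightarrow> real) \<Rightarrow> real \<Rightarrow> nat \<Rightarrow> real" where
  "gibbs d E \<beta> a = exp (- \<beta> * E a) / (\<Sum>b<d. exp (- \<beta> * E b))"

text \<open>Thermal state of the memory (trivial Hamiltonian).\<close>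
definition eta :: "nat \<Rightarrow> nat \<Rightarrow> real" where
  "eta N k = 1 / real N"

definition tensor :: "nat \<Rightarrow> (nat \<Rightarrow> real) \<Rightarrow> (nat \<Rightarrow> real) \<Rightarrow> nat \<Rightarrow> real" where
  "tensor N q m x = q (x div N) * m (x mod N)"

definition joint_gibbs :: "nat \<Rightarrow> nat \<Rightarrow> (nat \<Rightarrow> real) \<Rightarrow> real \<Rightarrow> nat \<Rightarrow> real" where
  "joint_gibbs d N E \<beta> = tensor N (gibbs d E \<beta>) (eta N)"

definition therm2 :: "(nat \<Rightarrow> real) \<Rightarrow> nat \<Rightarrow> nat \<Rightarrow> (nat \<Rightarrow> real) \<Rightarrow> nat \<Rightarrow> real" where
  "therm2 G x y Q = (\<lambda>z. if z = x then (Q x + Q y) * G x / (G x + G y)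
                         else if z = y then (Q x + Q y) * G y / (G x + G y)
                         else Q z)"

definition round_ij :: "nat \<Rightarrow> nat \<Rightarrow> (nat \<Rightarrow> real) \<Rightarrow> real \<Rightarrow> nat \<Rightarrow> nat \<Rightarrow> nat
                        \<Rightarrow> (nat \<Rightarrow> real) \<Rightarrow> nat \<Rightarrow> real" where
  "round_ij d N E \<beta> i j k Q =
     foldl (\<lambda>Q' l. therm2 (joint_gibbs d N E \<beta>) (j * N + k) (i * N + l) Q') Q [0..<N]"

definition Ptilde :: "nat \<Rightarrow> nat \<Rightarrow> (nat \<Rightarrow> real) \<Rightarrow> real \<Rightarrow> nat \<Rightarrow> nat
                        \<Rightarrow> (nat \<Rightarrow> real) \<Rightarrow> nat \<Rightarrow> real" where
  "Ptilde d N E \<beta> i j Q = foldl (\<lambda>Q' k. round_ij d N E \<beta> i j k Q') Q [0..<N]"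

definition marg :: "nat \<Rightarrow> (nat \<Rightarrow> real) \<Rightarrow> nat \<Rightarrow> real" where
  "marg N Q a = (\<Sum>k<N. Q (a * N + k))"

definition mem_therm :: "nat \<Rightarrow> (nat \<Rightarrow> real) \<Rightarrow> nat \<Rightarrow> real" where
  "mem_therm N Q = tensor N (marg N Q) (eta N)"

definition protocol :: "nat \<Rightarrow> nat \<Rightarrow> (nat \<Rightarrow> real) \<Rightarrow> real \<Rightarrow> nat \<Rightarrow> nat
                        \<Rightarrow> (nat \<Rightarrow> real) \<Rightarrow> nat \<Rightarrow> real" where
  "protocol d N E \<beta> i j Q = mem_therm N (Ptilde d N E \<beta> i j Q)"

text \<open>beta-swap Pi^beta_ij (for E i \<le> E j).\<close>
definition beta_swap :: "(nat \<Rightarrow> real) \<Rightarrow> real \<Rightarrow> nat \<Rightarrow> nat \<Rightarrow> (nat \<Rightarrow> real) \<Rightarrow> nat \<Rightarrow> real" where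
  "beta_swap E \<beta> i j p = (\<lambda>a.
     if a = i then (1 - exp (- \<beta> * (E j - E i))) * p i + p j
     else if a = j then exp (- \<beta> * (E j - E i)) * p i
     else p a)"

definition tvd :: "nat \<Rightarrow> (nat \<Rightarrow> real) \<Rightarrow> (nat \<Rightarrow> real) \<Rightarrow> real" where
  "tvd d p q = (1/2) * (\<Sum>a<d. \<bar>p a - q a\<bar>)"

end

theory Submission
  imports Defs "HOL-Analysis.Gamma_Function" "HOL-Real_Asymp.Real_Asymp"
begin

text \<open>Write \<open>a = \<Gamma>\<^sub>i\<close> and \<open>b = \<Gamma>\<^sub>j\<close>. The protocol is linear and fixes \<open>(a, b)\<close>, so splitting off the multiple of
  \<open>(a, b)\<close> that contains all of \<open>p\<^sub>i\<close> leaves the mass \<open>p\<^sub>j - (b / a) p\<^sub>i\<close> in level \<open>j\<close>, and the deviation from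
  the \<open>\<beta>\<close>-swap is exactly the part of it that is still in \<open>j\<close> at the end. A unit of this mass performs a
  lattice walk: each thermalisation puts it into \<open>j\<close> with probability \<open>b\<close> and into \<open>i\<close> with probability
  \<open>a\<close>, so the fraction ending in \<open>j\<close> is
  \<open>b\<^sup>N / N * (\<Sum>t<N. (N - t) * ((N + t - 1) choose t) * a\<^sup>t)\<close>. As \<open>a > 1/2\<close>, the terms with \<open>t\<close> close to
  \<open>N\<close> dominate: relative to a central binomial coefficient the term \<open>t = N - 1 - k\<close>, divided by
  \<open>a\<close> to the power \<open>N - 1\<close>, tends to \<open>(k + 1) / (2 a)\<^sup>k\<close>, and Tannery's theorem together with Wallis' product gives the
  asymptotics.\<close>

section \<open>The protocol as a lattice recursion\<close>

lemma block_index_eq_iff: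
  fixes a b k l N :: nat
  assumes "k < N" "l < N"
  shows "a * N + k = b * N + l \<longleftrightarrow> a = b \<and> k = l"
proof
  assume eq: "a * N + k = b * N + l"
  have "(a * N + k) div N = a" "(b * N + l) div N = b"
    using assms by auto
  with eq have "a = b" by simp
  with eq show "a = b \<and> k = l" by simp
qed simp

lemma gibbs_pos: "i < d \<Longrightarrow> gibbs d E \<beta> i > 0"
  unfolding gibbs_def by (intro divide_pos_pos sum_pos) auto

lemma gibbs_ratio: "i < d \<Longrightarrow> gibbs d E \<beta> j / gibbs d E \<beta> i = exp (- \<beta> * (E j - E i))"
proof -
  assume "i < d"
  hence "(\<Sum>b<d. exp (- \<beta> * E b)) > 0"
    by (intro sum_pos) auto
  thus ?thesis
    by (simp add: gibbs_def exp_diff [symmetric] algebra_simps)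
qed

lemma tensor_block: "k < N \<Longrightarrow> tensor N p (eta N) (a * N + k) = p a / real N"
  by (simp add: tensor_def eta_def)

text \<open>The factor 1/N common to both joint weights cancels, so every step mixes with the same
  two-level Gibbs weights, whatever \<open>k\<close> and \<open>l\<close> are.\<close>

lemma therm2_joint_gibbs:
  fixes E :: "nat \<Rightarrow> real" and \<beta> :: real
  assumes "i < d" "j < d" "i \<noteq> j" "k < N" "l < N"
  defines "gi \<equiv> gibbs d E \<beta> i" and "gj \<equiv> gibbs d E \<beta> j"
  shows "therm2 (joint_gibbs d N E \<beta>) (j * N + k) (i * N + l) Q =
         Q (j * N + k := gj / (gi + gj) * (Q (j * N + k) + Q (i * N + l)),
            i * N + l := gi / (gi + gj) * (Q (j * N + k) + Q (i * N + l)))"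
proof -
  have pos: "gi > 0" "gj > 0" "real N > 0"
    using assms gibbs_pos by (auto simp: gi_def gj_def)
  have G: "joint_gibbs d N E \<beta> (j * N + k) = gj / N" "joint_gibbs d N E \<beta> (i * N + l) = gi / N"
    using assms by (simp_all add: joint_gibbs_def tensor_block)
  have "j * N + k \<noteq> i * N + l"
    using assms block_index_eq_iff by metis
  moreover have "gj / N + gi / N = (gi + gj) / N"
    by (simp add: add_divide_distrib)
  ultimately show ?thesis
    using pos unfolding therm2_def G by (auto simp: fun_eq_iff)
qed

text \<open>Within a round the entry \<open>j * N + k\<close> meets each entry of block
  \<open>i\<close> exactly once, so \<open>X\<close> follows this one entry while \<open>Y\<close>
  turns into \<open>Y'\<close> cell by cell. Assuming only the recurrences allows any closed form to
  be plugged in later.\<close>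

lemma round_ij_blocks:
  fixes X Y Y' Q E :: "nat \<Rightarrow> real" and \<beta> :: real
  assumes ij: "i < d" "j < d" "i \<noteq> j" and k: "k < N"
  defines "gi \<equiv> gibbs d E \<beta> i" and "gj \<equiv> gibbs d E \<beta> j"
  assumes X: "\<And>l. X (Suc l) = gj / (gi + gj) * (X l + Y l)"
    and Y: "\<And>l. Y' l = gi / (gi + gj) * (X l + Y l)"
    and Q: "Q (j * N + k) = X 0" "\<And>l. l < N \<Longrightarrow> Q (i * N + l) = Y l"
  defines "R \<equiv> round_ij d N E \<beta> i j k Q"
  shows "R (j * N + k) = X N" "\<And>l. l < N \<Longrightarrow> R (i * N + l) = Y' l"
    "\<And>a m. a \<noteq> i \<Longrightarrow> m < N \<Longrightarrow> (a, m) \<noteq> (j, k) \<Longrightarrow> R (a * N + m) = Q (a * N + m)"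
proof -
  define S where "S = (\<lambda>n. foldl (\<lambda>Q' l. therm2 (joint_gibbs d N E \<beta>) (j * N + k) (i * N + l) Q') Q [0..<n])"
  have "n \<le> N \<Longrightarrow> S n (j * N + k) = X n \<and>
          (\<forall>l<N. S n (i * N + l) = (if l < n then Y' l else Y l)) \<and>
          (\<forall>a m. a \<noteq> i \<longrightarrow> m < N \<longrightarrow> (a, m) \<noteq> (j, k) \<longrightarrow> S n (a * N + m) = Q (a * N + m))" for n
  proof (induction n)
    case 0
    then show ?case using Q by (simp add: S_def)
  next
    case (Suc n)
    then have n: "n < N" by simp
    have S: "S (Suc n) = (S n)
        (j * N + k := gj / (gi + gj) * (S n (j * N + k) + S n (i * N + n)),
         i * N + n := gi / (gi + gj) * (S n (j * N + k) + S n (i * N + n)))"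
      using therm2_joint_gibbs[OF ij k n] by (simp add: S_def gi_def gj_def)
    have IH: "S n (j * N + k) = X n" "S n (i * N + n) = Y n"
      "\<And>l. l < N \<Longrightarrow> S n (i * N + l) = (if l < n then Y' l else Y l)"
      "\<And>a m. a \<noteq> i \<Longrightarrow> m < N \<Longrightarrow> (a, m) \<noteq> (j, k) \<Longrightarrow> S n (a * N + m) = Q (a * N + m)"
      using Suc n by auto
    have S': "S (Suc n) = (S n) (j * N + k := X (Suc n), i * N + n := Y' n)"
      unfolding S IH(1,2) X Y ..
    show ?case
      using ij k n IH(3,4) unfolding S' by (auto simp: block_index_eq_iff fun_upd_def)
  qed
  from this[of N] show "R (j * N + k) = X N" "\<And>l. l < N \<Longrightarrow> R (i * N + l) = Y' l"
    "\<And>a m. a \<noteq> i \<Longrightarrow> m < N \<Longrightarrow> (a, m) \<noteq> (j, k) \<Longrightarrow> R (a * N + m) = Q (a * N + m)"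
    by (auto simp: R_def S_def round_ij_def)
qed

text \<open>Here \<open>X k l\<close> is the entry \<open>j * N + k\<close> after \<open>l\<close> steps of round \<open>k\<close>, and \<open>Y k l\<close> is the entry
  \<open>i * N + l\<close> at the beginning of round \<open>k\<close>.\<close>

lemma Ptilde_blocks:
  fixes X Y :: "nat \<Rightarrow> nat \<Rightarrow> real" and Q E :: "nat \<Rightarrow> real" and \<beta> :: real
  assumes ij: "i < d" "j < d" "i \<noteq> j"
  defines "gi \<equiv> gibbs d E \<beta> i" and "gj \<equiv> gibbs d E \<beta> j"
  assumes X: "\<And>k l. X k (Suc l) = gj / (gi + gj) * (X k l + Y k l)"
    and Y: "\<And>k l. Y (Suc k) l = gi / (gi + gj) * (X k l + Y k l)"
    and Q: "\<And>k. k < N \<Longrightarrow> Q (j * N + k) = X k 0" "\<And>l. l < N \<Longrightarrow> Q (i * N + l) = Y 0 l"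
  defines "P \<equiv> Ptilde d N E \<beta> i j Q"
  shows "\<And>k. k < N \<Longrightarrow> P (j * N + k) = X k N" "\<And>l. l < N \<Longrightarrow> P (i * N + l) = Y N l"
    "\<And>a m. a \<noteq> i \<Longrightarrow> a \<noteq> j \<Longrightarrow> m < N \<Longrightarrow> P (a * N + m) = Q (a * N + m)"
proof -
  define S where "S = (\<lambda>n. foldl (\<lambda>Q' k. round_ij d N E \<beta> i j k Q') Q [0..<n])"
  have "n \<le> N \<Longrightarrow> (\<forall>k<N. S n (j * N + k) = (if k < n then X k N else X k 0)) \<and>
          (\<forall>l<N. S n (i * N + l) = Y n l) \<and>
          (\<forall>a m. a \<noteq> i \<longrightarrow> a \<noteq> j \<longrightarrow> m < N \<longrightarrow> S n (a * N + m) = Q (a * N + m))" for n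
  proof (induction n)
    case 0
    then show ?case using Q by (simp add: S_def)
  next
    case (Suc n)
    then have n: "n < N" by simp
    have S: "S (Suc n) = round_ij d N E \<beta> i j n (S n)"
      by (simp add: S_def)
    have start: "S n (j * N + n) = X n 0" "\<And>l. l < N \<Longrightarrow> S n (i * N + l) = Y n l"
      using Suc n by auto
    note round = round_ij_blocks[where X = "X n" and Y = "Y n" and Y' = "Y (Suc n)" and k = n
        and Q = "S n", OF ij n X[unfolded gi_def gj_def] Y[unfolded gi_def gj_def] start, folded S]
    show ?case
    proof (intro conjI allI impI)
      fix k assume "k < N"
      show "S (Suc n) (j * N + k) = (if k < Suc n then X k N else X k 0)"
      proof (cases "k = n")
        case True
        then show ?thesis using round(1) by simp
      next
        case False
        then show ?thesis using round(3)[of j k] Suc ij \<open>k < N\<close> by auto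
      qed
    qed (use round(2) round(3) Suc in auto)
  qed
  from this[of N] show "\<And>k. k < N \<Longrightarrow> P (j * N + k) = X k N" "\<And>l. l < N \<Longrightarrow> P (i * N + l) = Y N l"
    "\<And>a m. a \<noteq> i \<Longrightarrow> a \<noteq> j \<Longrightarrow> m < N \<Longrightarrow> P (a * N + m) = Q (a * N + m)"
    by (auto simp: P_def S_def Ptilde_def)
qed

section \<open>Solution of the recursion\<close>

text \<open>Conservation of flux: each lattice point passes on what it receives, so the flow out of
  a rectangle through its far sides equals the flow in. This yields \<open>q i\<close> from
  \<open>q j\<close> without a second closed form.\<close>

lemma lattice_recursion_mass:
  fixes X Y :: "nat \<Rightarrow> nat \<Rightarrow> real"
  assumes step: "\<And>k l. X k (Suc l) + Y (Suc k) l = X k l + Y k l"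
  shows "(\<Sum>k<m. X k n) + (\<Sum>l<n. Y m l) = (\<Sum>k<m. X k 0) + (\<Sum>l<n. Y 0 l)"
proof (induction m)
  case (Suc m)
  have "X m n + (\<Sum>l<n. Y (Suc m) l) = X m 0 + (\<Sum>l<n. Y m l)"
  proof (induction n)
    case (Suc n)
    then show ?case using step[of m n] by simp
  qed simp
  with Suc show ?case by simp
qed simp

text \<open>Expected numbers of arrivals at \<open>(k, l)\<close> along the \<open>l\<close>- and the \<open>k\<close>-direction, for walkers that enter
  at every point \<open>(k, 0)\<close>. For \<open>l = 0\<close> the truncated binomial \<open>(l + t - 1) choose t\<close> is nonzero at
  \<open>t = 0\<close> only.\<close>

definition walk_l :: "real \<Rightarrow> real \<Rightarrow> nat \<Rightarrow> nat \<Rightarrow> real" where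
  "walk_l a b k l = b ^ l * (\<Sum>t\<le>k. real ((l + t - 1) choose t) * a ^ t)"

definition walk_k :: "real \<Rightarrow> real \<Rightarrow> nat \<Rightarrow> nat \<Rightarrow> real" where
  "walk_k a b k l = a * b ^ l * (\<Sum>t<k. real ((l + t) choose t) * a ^ t)"

lemma walk_l_0: "walk_l a b k 0 = 1"
proof -
  have "(\<Sum>t\<le>k. real ((t - 1) choose t) * a ^ t) = (\<Sum>t\<in>{0}. real ((t - 1) choose t) * a ^ t)"
    by (intro sum.mono_neutral_right) auto
  then show ?thesis by (simp add: walk_l_def)
qed

lemma walk_k_0: "walk_k a b 0 l = 0"
  by (simp add: walk_k_def)

text \<open>Pascal's rule term by term. After multiplication by \<open>b ^ l\<close>, the left side
  is the expected number of visits to \<open>(k, l)\<close>, the sum of the arrivals from both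
  directions; \<open>b\<close> and \<open>a\<close> times it are the next arrivals.\<close>

lemma walk_pascal:
  fixes a :: real
  shows "(\<Sum>t\<le>k. real ((l + t) choose t) * a ^ t) =
         (\<Sum>t\<le>k. real ((l + t - 1) choose t) * a ^ t) + a * (\<Sum>t<k. real ((l + t) choose t) * a ^ t)"
proof (induction k)
  case (Suc k)
  have "(l + Suc k) choose Suc k = ((l + Suc k - 1) choose Suc k) + ((l + k) choose k)"
    by simp
  then have "real ((l + Suc k) choose Suc k) * a ^ Suc k =
      real ((l + Suc k - 1) choose Suc k) * a ^ Suc k + a * (real ((l + k) choose k) * a ^ k)"
    by (simp add: algebra_simps)
  with Suc show ?case
    by (simp add: algebra_simps)
qed simp

lemma walk_l_Suc: "walk_l a b k (Suc l) = b * (walk_l a b k l + walk_k a b k l)"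
  using walk_pascal[of l a k] by (simp add: walk_l_def walk_k_def algebra_simps)

lemma walk_k_Suc: "walk_k a b (Suc k) l = a * (walk_l a b k l + walk_k a b k l)"
  using walk_pascal[of l a k]
  by (simp add: walk_l_def walk_k_def algebra_simps lessThan_Suc_atMost)

text \<open>Interchange of summation: the term with index \<open>t\<close> occurs once for each
  \<open>k\<close> from \<open>t\<close> to \<open>N - 1\<close>.\<close>

lemma sum_walk_l:
  assumes "N > 0"
  shows "(\<Sum>k<N. walk_l a b k N) =
         b ^ N * (\<Sum>t<N. real (N - t) * real ((N + t - 1) choose t) * a ^ t)"
proof -
  have "(\<Sum>k<n. \<Sum>t\<le>k. f t) = (\<Sum>t<n. real (n - t) * f t)" for n and f :: "nat \<Rightarrow> real"
  proof (induction n)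
    case (Suc n)
    have "(\<Sum>t<Suc n. real (Suc n - t) * f t) = (\<Sum>t<Suc n. real (n - t) * f t + f t)"
      by (intro sum.cong) (auto simp: Suc_diff_le algebra_simps)
    also have "\<dots> = (\<Sum>t<n. real (n - t) * f t) + (\<Sum>t\<le>n. f t)"
      by (simp add: sum.distrib lessThan_Suc_atMost[symmetric])
    finally show ?case using Suc by simp
  qed simp
  from this[of "\<lambda>t. real ((N + t - 1) choose t) * a ^ t" N] show ?thesis
    by (simp add: walk_l_def sum_distrib_left[symmetric] mult.assoc)
qed

section \<open>Exact distance to the beta-swap\<close>

text \<open>For \<open>N > 0\<close>, the average of \<open>walk_l a b k N\<close> over
  \<open>k < N\<close>: the fraction of mass spread evenly over block \<open>j\<close> that ends
  there.\<close>

definition residual :: "real \<Rightarrow> real \<Rightarrow> nat \<Rightarrow> real" where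
  "residual a b N = b ^ N / real N * (\<Sum>t<N. real (N - t) * real ((N + t - 1) choose t) * a ^ t)"

lemma tvd_protocol:
  fixes E p :: "nat \<Rightarrow> real" and \<beta> :: real
  assumes ij: "i < d" "j < d" "i \<noteq> j" and N: "N > 0"
  defines "Gi \<equiv> gibbs d E \<beta> i / (gibbs d E \<beta> i + gibbs d E \<beta> j)"
    and "Gj \<equiv> gibbs d E \<beta> j / (gibbs d E \<beta> i + gibbs d E \<beta> j)"
  defines "q \<equiv> marg N (Ptilde d N E \<beta> i j (tensor N p (eta N)))"
  shows "tvd d q (beta_swap E \<beta> i j p) = \<bar>p i * Gj - p j * Gi\<bar> / Gi * residual Gi Gj N"
proof -
  define P where "P = Ptilde d N E \<beta> i j (tensor N p (eta N))"
  have g: "gibbs d E \<beta> i > 0" "gibbs d E \<beta> j > 0"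
    using ij gibbs_pos by auto
  have G: "Gi > 0" "Gj > 0" "Gi + Gj = 1"
    using g by (auto simp: Gi_def Gj_def add_divide_distrib[symmetric])
  have ratio: "exp (- \<beta> * (E j - E i)) = Gj / Gi"
    using gibbs_ratio[OF ij(1), of E \<beta> j] g by (simp add: Gi_def Gj_def)
  define D where "D = p j - Gj / Gi * p i"
  \<comment> \<open>A stationary part, \<open>p i / Gi\<close> times \<open>(Gi, Gj)\<close>, plus
    \<open>D\<close> times the walk. On the entry sides \<open>walk_l\<close> is 1 and
    \<open>walk_k\<close> is 0, which reproduces the initial state.\<close>
  define X where "X = (\<lambda>k l. (Gj / Gi * p i + D * walk_l Gi Gj k l) / real N)"
  define Y where "Y = (\<lambda>k l. (p i + D * walk_k Gi Gj k l) / real N)"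
  have eq: "Gj / Gi * p i + p i = p i / Gi"
  proof -
    have "Gj / Gi * p i + p i = (Gj + Gi) * p i / Gi"
      using G(1) by (simp add: field_simps)
    then show ?thesis using G(3) by (simp add: add.commute)
  qed
  have XY: "X k l + Y k l = (p i / Gi + D * (walk_l Gi Gj k l + walk_k Gi Gj k l)) / real N" for k l
    unfolding X_def Y_def eq[symmetric] by (simp add: add_divide_distrib algebra_simps)
  have X: "X k (Suc l) = Gj * (X k l + Y k l)" for k l
    unfolding XY unfolding X_def walk_l_Suc by (simp add: algebra_simps)
  have Y: "Y (Suc k) l = Gi * (X k l + Y k l)" for k l
    unfolding XY unfolding Y_def walk_k_Suc using G(1) by (simp add: algebra_simps)
  have X0: "X k 0 = p j / real N" and Y0: "Y 0 l = p i / real N" for k l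
    by (simp_all add: X_def Y_def walk_l_0 walk_k_0 D_def)
  note blocks = Ptilde_blocks[where X = X and Y = Y and N = N and Q = "tensor N p (eta N)", OF ij
      X[unfolded Gi_def Gj_def] Y[unfolded Gi_def Gj_def], unfolded tensor_block X0 Y0, folded P_def]
  have qj: "q j = Gj / Gi * p i + D * residual Gi Gj N"
  proof -
    have "q j = (\<Sum>k<N. X k N)"
      using blocks(1) by (auto simp: q_def marg_def P_def tensor_block)
    also have "\<dots> = Gj / Gi * p i + D * ((\<Sum>k<N. walk_l Gi Gj k N) / real N)"
      using N by (simp add: X_def sum_divide_distrib[symmetric] sum.distrib sum_distrib_left[symmetric] add_divide_distrib)
    finally show ?thesis
      by (simp add: sum_walk_l[OF N] residual_def)
  qed
  have qij: "q i + q j = p i + p j"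
  proof -
    have "q j + q i = (\<Sum>k<N. X k N) + (\<Sum>l<N. Y N l)"
      using blocks(1,2) by (auto simp: q_def marg_def P_def tensor_block)
    also have "\<dots> = (\<Sum>k<N. X k 0) + (\<Sum>l<N. Y 0 l)"
    proof (rule lattice_recursion_mass)
      fix k l
      have "X k (Suc l) + Y (Suc k) l = (Gi + Gj) * (X k l + Y k l)"
        unfolding X Y by (simp add: algebra_simps)
      then show "X k (Suc l) + Y (Suc k) l = X k l + Y k l"
        using G(3) by simp
    qed
    finally show ?thesis using N by (simp add: X0 Y0)
  qed
  have other: "q a = p a" if "a \<noteq> i" "a \<noteq> j" for a
    using blocks(3)[OF _ _ that] N by (simp add: q_def marg_def P_def tensor_block)
  have "tvd d q (beta_swap E \<beta> i j p) = 1/2 * (\<Sum>a\<in>{i, j}. \<bar>q a - beta_swap E \<beta> i j p a\<bar>)"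
    unfolding tvd_def using ij other
    by (intro arg_cong[where f = "\<lambda>x. 1/2 * x"] sum.mono_neutral_right) (auto simp: beta_swap_def)
  also have "\<dots> = \<bar>q j - Gj / Gi * p i\<bar>"
  proof -
    \<comment> \<open>The beta-swap and the protocol both conserve the total of levels
      \<open>i\<close> and \<open>j\<close>, so the two deviations are opposite and the factor 1/2
      disappears.\<close>
    have "q i - beta_swap E \<beta> i j p i = - (q j - Gj / Gi * p i)"
      using qij unfolding beta_swap_def ratio by (simp add: algebra_simps)
    moreover have "q j - beta_swap E \<beta> i j p j = q j - Gj / Gi * p i"
      using ij(3) unfolding beta_swap_def ratio by simp
    ultimately show ?thesis using ij(3) by simp
  qed
  also have "\<dots> = \<bar>D\<bar> * residual Gi Gj N"
  proof -
    have "residual Gi Gj N \<ge> 0"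
      unfolding residual_def using G(1,2)
      by (intro mult_nonneg_nonneg divide_nonneg_nonneg sum_nonneg) auto
    then show ?thesis by (simp add: qj abs_mult)
  qed
  also have "\<bar>D\<bar> = \<bar>p i * Gj - p j * Gi\<bar> / Gi"
  proof -
    have "D = - (p i * Gj - p j * Gi) / Gi"
      using G(1) by (simp add: D_def field_simps)
    then show ?thesis using G(1) by simp
  qed
  finally show ?thesis .
qed

section \<open>Asymptotics\<close>

lemma central_binomial_Suc:
  "real ((2 * Suc n) choose Suc n) = real ((2 * n) choose n) * (2 * (2 * real n + 1) / (real n + 1))"
proof -
  have "Suc n * Suc n * ((2 * Suc n) choose Suc n) = (2 * n + 2) * (2 * n + 1) * ((2 * n) choose n)"
  proof -
    have "Suc n * ((2 * Suc n) choose Suc n) = (2 * n + 2) * ((2 * n + 1) choose n)"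
      using Suc_times_binomial_eq[of "2 * n + 1" n] by simp
    \<comment> \<open>Symmetry replaces the lower index \<open>n\<close> by \<open>n + 1\<close>, so
      that absorption applies a second time.\<close>
    moreover have "Suc n * ((2 * n + 1) choose n) = (2 * n + 1) * ((2 * n) choose n)"
      using Suc_times_binomial_eq[of "2 * n" n] binomial_symmetric[of n "2 * n + 1"] by simp
    ultimately show ?thesis by (metis mult.assoc mult.left_commute)
  qed
  then have "real (Suc n * Suc n * ((2 * Suc n) choose Suc n)) =
      real ((2 * n + 2) * (2 * n + 1) * ((2 * n) choose n))"
    by (rule arg_cong)
  then have "(real n + 1) * ((real n + 1) * real ((2 * Suc n) choose Suc n)) =
      (real n + 1) * (2 * (2 * real n + 1) * real ((2 * n) choose n))"
    by (simp only: of_nat_mult of_nat_add of_nat_Suc of_nat_numeral) (simp add: algebra_simps)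
  then have "(real n + 1) * real ((2 * Suc n) choose Suc n) = 2 * (2 * real n + 1) * real ((2 * n) choose n)"
    by (subst (asm) mult_cancel_left) linarith
  then show ?thesis by (simp add: field_simps)
qed

text \<open>Each new Wallis factor is the inverse square of the growth factor of the normalised
  central binomial, times \<open>(2 * n + 1) / (2 * n + 3)\<close>.\<close>

lemma wallis_product_central_binomial:
  "(\<Prod>k=1..n. (4 * real k ^ 2) / (4 * real k ^ 2 - 1)) =
   1 / ((real ((2 * n) choose n) / 4 ^ n) ^ 2 * (2 * real n + 1))"
proof (induction n)
  case (Suc n)
  let ?c = "real ((2 * n) choose n)"
  have c: "?c > 0" by simp
  have "4 * real (Suc n) ^ 2 - 1 = (2 * real n + 1) * (2 * real n + 3)"
    by (simp add: power2_eq_square algebra_simps)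
  then have "(\<Prod>k=1..Suc n. (4 * real k ^ 2) / (4 * real k ^ 2 - 1)) =
      1 / ((?c / 4 ^ n) ^ 2 * (2 * real n + 1)) * (4 * (real n + 1) ^ 2 / ((2 * real n + 1) * (2 * real n + 3)))"
    using Suc by (simp add: add.commute)
  also have "\<dots> = 1 / ((?c * (2 * (2 * real n + 1) / (real n + 1)) / 4 ^ Suc n) ^ 2 * (2 * real (Suc n) + 1))"
  proof -
    have "1 / ((x / y) ^ 2 * u) * (4 * w ^ 2 / (u * v)) = 1 / ((x * (2 * u / w) / (4 * y)) ^ 2 * v)"
      if "x > 0" "y > 0" "u > 0" "v > 0" "w > 0" for x y u v w :: real
      using that by (simp add: field_simps power2_eq_square)
    from this[of ?c "4 ^ n" "2 * real n + 1" "2 * real n + 3" "real n + 1"] show ?thesis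
      using c by (simp add: add.commute)
  qed
  finally show ?case by (simp only: central_binomial_Suc)
qed simp

text \<open>The root is taken of \<open>n + 1\<close> because the coefficient is used with
  \<open>n = N - 1\<close>.\<close>

lemma central_binomial_asymptotic:
  "(\<lambda>n. real ((2 * n) choose n) / 4 ^ n * sqrt (real n + 1)) \<longlonglongrightarrow> 1 / sqrt pi"
proof -
  let ?c = "\<lambda>n. real ((2 * n) choose n) / 4 ^ n"
  have "(\<lambda>n. 1 / (?c n ^ 2 * (2 * real n + 1))) \<longlonglongrightarrow> pi / 2"
    using wallis by (simp only: wallis_product_central_binomial)
  from tendsto_inverse[OF this] have "(\<lambda>n. ?c n ^ 2 * (2 * real n + 1)) \<longlonglongrightarrow> 2 / pi"
    by (simp add: field_simps)
  moreover have "(\<lambda>n. (real n + 1) / (2 * real n + 1)) \<longlonglongrightarrow> 1 / 2"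
    by real_asymp
  ultimately have "(\<lambda>n. ?c n ^ 2 * (2 * real n + 1) * ((real n + 1) / (2 * real n + 1))) \<longlonglongrightarrow> 2 / pi * (1 / 2)"
    by (rule tendsto_mult)
  moreover have "?c n ^ 2 * (2 * real n + 1) * ((real n + 1) / (2 * real n + 1)) = ?c n ^ 2 * (real n + 1)" for n
  proof -
    have "2 * real n + 1 \<noteq> 0" by linarith
    then show ?thesis by simp
  qed
  ultimately have "(\<lambda>n. ?c n ^ 2 * (real n + 1)) \<longlonglongrightarrow> 1 / pi"
    by simp
  from tendsto_real_sqrt[OF this] show ?thesis
    by (simp add: real_sqrt_mult real_sqrt_divide)
qed

section \<open>Limit of the sum counted from its top term\<close>

text \<open>Absorption lowers both indices by one at the cost of one factor, which tends to 1/2 as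
  \<open>M\<close> grows.\<close>

lemma choose_ratio_prod:
  assumes "k \<le> M"
  shows "real ((2 * M - k) choose (M - k)) =
         real ((2 * M) choose M) * (\<Prod>i<k. (real M - real i) / (2 * real M - real i))"
  using assms
proof (induction k)
  case (Suc k)
  have k: "k < M" using Suc by simp
  have *: "2 * M - k = Suc (2 * M - Suc k)" "M - k = Suc (M - Suc k)"
    using k by auto
  have "(M - k) * ((2 * M - k) choose (M - k)) = (2 * M - k) * ((2 * M - Suc k) choose (M - Suc k))"
    using Suc_times_binomial_eq[of "2 * M - Suc k" "M - Suc k"] unfolding * by simp
  then have "real ((M - k) * ((2 * M - k) choose (M - k))) =
      real ((2 * M - k) * ((2 * M - Suc k) choose (M - Suc k)))"
    by (rule arg_cong)
  then have "(real M - real k) * real ((2 * M - k) choose (M - k)) =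
      (2 * real M - real k) * real ((2 * M - Suc k) choose (M - Suc k))"
    using k by (simp only: of_nat_mult) (simp add: of_nat_diff)
  then have "real ((2 * M - Suc k) choose (M - Suc k)) =
      real ((2 * M - k) choose (M - k)) * ((real M - real k) / (2 * real M - real k))"
    using k by (simp add: field_simps)
  then show ?case using Suc by simp
qed simp

text \<open>Uniform in \<open>M\<close>, as domination requires: factors with \<open>i < M\<close>
  are at most 1/2, and for \<open>k > M\<close> the factor \<open>i = M\<close> vanishes.\<close>

lemma choose_ratio_prod_bound:
  "\<bar>\<Prod>i<k. (real M - real i) / (2 * real M - real i)\<bar> \<le> (1 / 2) ^ k"
proof (cases "k \<le> M")
  case True
  have "(\<Prod>i<k. \<bar>(real M - real i) / (2 * real M - real i)\<bar>) \<le> (\<Prod>i<k. 1 / 2)"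
    by (rule prod_mono) (use True in \<open>auto simp: field_simps\<close>)
  then show ?thesis by (simp add: abs_prod)
next
  case False
  then have zero: "(\<Prod>i<k. (real M - real i) / (2 * real M - real i)) = 0"
    by (intro prod_zero bexI[of _ M]) auto
  show ?thesis unfolding zero by simp
qed

text \<open>The sum in \<open>residual a b (Suc M)\<close>, counted from the top and normalised by its leading term.\<close>

definition top_sum :: "real \<Rightarrow> nat \<Rightarrow> real" where
  "top_sum a M =
     (\<Sum>k\<le>M. (real k + 1) * (real ((2 * M - k) choose (M - k)) / real ((2 * M) choose M)) / a ^ k)"

lemma top_sum_limit:
  fixes a :: real
  assumes a: "a > 1 / 2"
  shows "top_sum a \<longlonglongrightarrow> 4 * a ^ 2 / (2 * a - 1) ^ 2"
proof -
  define \<rho> where "\<rho> = (\<lambda>k M. \<Prod>i<k. (real M - real i) / (2 * real M - real i))"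
  define f where "f = (\<lambda>k M. (real k + 1) * \<rho> k M / a ^ k)"
  \<comment> \<open>Both the pointwise limit of \<open>f\<close> and its majorant; summable exactly
    because \<open>a > 1/2\<close> makes the ratio less than 1.\<close>
  define g where "g = (\<lambda>k. real (Suc k) * (1 / (2 * a)) ^ k)"
  have "norm (1 / (2 * a)) < 1" using a by simp
  from geometric_deriv_sums[OF this]
  have g: "g sums (1 / (1 - 1 / (2 * a)) ^ 2)"
    by (simp add: g_def)
  have g_eq: "g k = (real k + 1) * (1 / 2) ^ k / a ^ k" for k
    by (simp add: g_def power_divide power_mult_distrib add.commute)
  have lim: "((\<lambda>M. f k M) \<longlonglongrightarrow> g k)" for k
  proof -
    have "(\<lambda>M. (real M - real i) / (2 * real M - real i)) \<longlonglongrightarrow> 1 / 2" for i :: nat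
      by real_asymp
    then have "(\<lambda>M. \<rho> k M) \<longlonglongrightarrow> (\<Prod>i<k. 1 / 2)"
      unfolding \<rho>_def by (intro tendsto_prod) auto
    then have "(\<lambda>M. \<rho> k M) \<longlonglongrightarrow> (1 / 2) ^ k" by simp
    then show ?thesis
      unfolding f_def g_eq using a by (intro tendsto_intros) auto
  qed
  have bound: "norm (f k M) \<le> g k" for k M
    using choose_ratio_prod_bound[of M k] a
    unfolding f_def g_eq \<rho>_def
    by (simp add: abs_mult divide_right_mono mult_left_mono)
  have "(\<lambda>M. suminf (\<lambda>k. f k M)) \<longlonglongrightarrow> suminf g"
    by (rule tannerys_theorem[where M = g, THEN conjunct2, THEN conjunct2])
       (use lim bound sums_summable[OF g] in \<open>auto intro: always_eventually\<close>)
  \<comment> \<open>The product vanishes for \<open>k > M\<close>, so the series is the finite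
    sum.\<close>
  moreover have "suminf (\<lambda>k. f k M) = top_sum a M" for M
  proof -
    have "suminf (\<lambda>k. f k M) = (\<Sum>k\<le>M. f k M)"
    proof (rule suminf_finite)
      fix k assume "k \<notin> {..M}"
      then have "\<rho> k M = 0" unfolding \<rho>_def by (intro prod_zero bexI[of _ M]) auto
      then show "f k M = 0" by (simp add: f_def)
    qed simp
    also have "\<dots> = top_sum a M"
      unfolding top_sum_def by (intro sum.cong refl) (simp add: f_def \<rho>_def choose_ratio_prod)
    finally show ?thesis .
  qed
  moreover have "suminf g = 4 * a ^ 2 / (2 * a - 1) ^ 2"
  proof -
    have "1 - 1 / (2 * a) = (2 * a - 1) / (2 * a)"
      using a by (simp add: field_simps)
    then show ?thesis
      using sums_unique[OF g] by (simp add: power_divide power_mult_distrib)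
  qed
  ultimately show ?thesis by simp
qed

section \<open>Asymptotics of the residual fraction\<close>

text \<open>Reversing the sum by \<open>t = M - k\<close> turns the weight \<open>N - t\<close> into
  \<open>k + 1\<close> and exposes the central binomial as the leading coefficient.\<close>

lemma residual_Suc:
  assumes "a > 0"
  shows "residual a b (Suc M) = b * (a * b) ^ M / (real M + 1) * real ((2 * M) choose M) * top_sum a M"
proof -
  let ?N = "Suc M"
  let ?f = "\<lambda>t. real (?N - t) * real ((?N + t - 1) choose t) * a ^ t"
  have "(\<Sum>t<?N. ?f t) = (\<Sum>k<?N. ?f (?N - Suc k))"
    by (rule sum.nat_diff_reindex[symmetric])
  also have "\<dots> = (\<Sum>k\<le>M. a ^ M * (real ((2 * M) choose M)) *
      ((real k + 1) * (real ((2 * M - k) choose (M - k)) / real ((2 * M) choose M)) / a ^ k))"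
    unfolding lessThan_Suc_atMost
  proof (intro sum.cong refl)
    fix k assume "k \<in> {..M}"
    then have k: "k \<le> M" by simp
    have "real (?N - (?N - Suc k)) = real k + 1" using k by (simp add: of_nat_diff)
    moreover have "?N + (?N - Suc k) - 1 = 2 * M - k" "?N - Suc k = M - k" using k by auto
    moreover have "a ^ (M - k) = a ^ M / a ^ k" using k assms by (simp add: power_diff)
    ultimately show "?f (?N - Suc k) = a ^ M * (real ((2 * M) choose M)) *
      ((real k + 1) * (real ((2 * M - k) choose (M - k)) / real ((2 * M) choose M)) / a ^ k)"
      by simp
  qed
  also have "\<dots> = a ^ M * real ((2 * M) choose M) * top_sum a M"
    unfolding top_sum_def by (rule sum_distrib_left[symmetric])
  finally have sum: "(\<Sum>t<?N. ?f t) = \<dots>" .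
  show ?thesis
    unfolding residual_def sum by (simp add: power_mult_distrib add.commute)
qed

text \<open>The normalisation leaves a product of two factors: the scaled central binomial, with
  limit \<open>1 / sqrt pi\<close>, and \<open>top_sum\<close> over its limit. Here
  \<open>2 * a - 1 = a - b\<close>.\<close>

lemma residual_asymptotic:
  assumes ab: "a > 0" "b > 0" "a + b = 1" "b < a"
  shows "(\<lambda>N. residual a b N * (a - b) ^ 2 / (a * (4 * a * b) ^ N) * (real N * sqrt (real N)))
           \<longlonglongrightarrow> 1 / sqrt pi"
proof -
  have "a > 1 / 2" using ab by linarith
  have D: "2 * a - 1 = a - b" "a - b \<noteq> 0" using ab by auto
  have T: "top_sum a \<longlonglongrightarrow> 4 * a ^ 2 / (a - b) ^ 2"
    unfolding D(1)[symmetric] by (rule top_sum_limit) fact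
  have "(\<lambda>M. real ((2 * M) choose M) / 4 ^ M * sqrt (real M + 1) * (top_sum a M * ((a - b) ^ 2 / (4 * a ^ 2))))
      \<longlonglongrightarrow> 1 / sqrt pi * (4 * a ^ 2 / (a - b) ^ 2 * ((a - b) ^ 2 / (4 * a ^ 2)))"
    by (intro tendsto_mult central_binomial_asymptotic T tendsto_const)
  also have "4 * a ^ 2 / (a - b) ^ 2 * ((a - b) ^ 2 / (4 * a ^ 2)) = 1"
    using ab by simp
  also have "(\<lambda>M. real ((2 * M) choose M) / 4 ^ M * sqrt (real M + 1) * (top_sum a M * ((a - b) ^ 2 / (4 * a ^ 2)))) =
    (\<lambda>M. residual a b (Suc M) * (a - b) ^ 2 / (a * (4 * a * b) ^ Suc M) * (real (Suc M) * sqrt (real (Suc M))))"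
  proof
    fix M
    have R: "residual a b (Suc M) = b * (a * b) ^ M / real (Suc M) * real ((2 * M) choose M) * top_sum a M"
      using residual_Suc[of a b M] ab by (simp add: add.commute)
    have pow: "(4 * a * b) ^ Suc M = 4 * a * b * (4 ^ M * (a * b) ^ M)"
      by (simp add: power_mult_distrib)
    have "B / F * s * (t * (e / (4 * a ^ 2))) = b * z / m * B * t * e / (a * (4 * a * b * (F * z))) * (m * s)"
      if "F > 0" "m > 0" "z > 0" for B F s t e m z :: real
      using ab that by (simp add: field_simps power2_eq_square)
    from this[of "4 ^ M" "real (Suc M)" "(a * b) ^ M"] show "real ((2 * M) choose M) / 4 ^ M * sqrt (real M + 1) * (top_sum a M * ((a - b) ^ 2 / (4 * a ^ 2))) =
      residual a b (Suc M) * (a - b) ^ 2 / (a * (4 * a * b) ^ Suc M) * (real (Suc M) * sqrt (real (Suc M)))"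
      unfolding R pow using ab by (simp add: add.commute)
  qed
  finally have "(\<lambda>M. residual a b (Suc M) * (a - b) ^ 2 / (a * (4 * a * b) ^ Suc M) * (real (Suc M) * sqrt (real (Suc M))))
    \<longlonglongrightarrow> 1 / sqrt pi" by simp
  then show ?thesis by (subst (asm) filterlim_sequentially_Suc)
qed

text \<open>Both terms are \<open>c / sqrt pi\<close> times \<open>N powr (-3/2)\<close> to leading
  order; writing \<open>N + 1\<close> for \<open>N\<close> in the second changes it by a factor
  tending to 1.\<close>

lemma residual_remainder:
  assumes ab: "a > 0" "b > 0" "a + b = 1" "b < a"
  shows "(\<lambda>N. c / a * residual a b N * (a - b) ^ 2 / (4 * a * b) ^ N - c / ((real N + 1) * sqrt (pi * real N)))
           \<in> o(\<lambda>N. real N powr (-3/2))"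
proof (rule smalloI_tendsto)
  let ?A = "\<lambda>N. residual a b N * (a - b) ^ 2 / (a * (4 * a * b) ^ N) * (real N * sqrt (real N))"
  have "(\<lambda>N. c * ?A N - c * (real N / (real N + 1) * (1 / sqrt pi))) \<longlonglongrightarrow> c * (1 / sqrt pi) - c * (1 * (1 / sqrt pi))"
  proof (intro tendsto_diff tendsto_mult tendsto_const residual_asymptotic ab)
    show "(\<lambda>N. real N / (real N + 1)) \<longlonglongrightarrow> 1" by real_asymp
  qed
  then have lim: "(\<lambda>N. c * ?A N - c * (real N / (real N + 1) * (1 / sqrt pi))) \<longlonglongrightarrow> 0" by simp
  show "(\<lambda>N. (c / a * residual a b N * (a - b) ^ 2 / (4 * a * b) ^ N - c / ((real N + 1) * sqrt (pi * real N)))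
           / real N powr (-3/2)) \<longlonglongrightarrow> 0"
  \<comment> \<open>Restricted to \<open>N > 0\<close>, since \<open>real N powr (-3/2)\<close> is 0
    at \<open>N = 0\<close>.\<close>
  proof (rule Lim_transform_eventually[OF lim], rule eventually_mono[OF eventually_gt_at_top[of 0]])
    fix N :: nat assume N: "N > 0"
    have "real N powr (-3/2) = real N powr (-1) * real N powr (- (1/2))"
      using powr_add[of "real N" "-1" "- (1/2)"] by simp
    also have "\<dots> = 1 / (real N * sqrt (real N))"
      using N by (simp add: powr_minus powr_half_sqrt field_simps)
    finally have powr: "real N powr (-3/2) = 1 / (real N * sqrt (real N))" .
    have "c / ((real N + 1) * sqrt (pi * real N)) * (real N * sqrt (real N)) = c * (real N / (real N + 1) * (1 / sqrt pi))"
      using N by (simp add: real_sqrt_mult)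
    then show "c * ?A N - c * (real N / (real N + 1) * (1 / sqrt pi)) =
      (c / a * residual a b N * (a - b) ^ 2 / (4 * a * b) ^ N - c / ((real N + 1) * sqrt (pi * real N))) / real N powr (-3/2)"
      unfolding powr by (simp add: left_diff_distrib)
  qed
qed (auto intro: eventually_mono[OF eventually_gt_at_top[of 0]])

theorem theorem2:
  fixes d i j :: nat and E :: "nat \<Rightarrow> real" and \<beta> :: real and p :: "nat \<Rightarrow> real"
  assumes "d \<ge> 2" and "\<beta> > 0" and "i < d" and "j < d" and "i \<noteq> j" and "E i < E j"
    and "prob_vec d p"
  shows "let Gi = gibbs d E \<beta> i / (gibbs d E \<beta> i + gibbs d E \<beta> j);
             Gj = gibbs d E \<beta> j / (gibbs d E \<beta> i + gibbs d E \<beta> j)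
         in \<exists>r :: nat \<Rightarrow> real. r \<in> o(\<lambda>N. real N powr (-3/2)) \<and>
            (\<forall>N \<ge> 1. \<exists>q. protocol d N E \<beta> i j (tensor N p (eta N)) = tensor N q (eta N) \<and>
                tvd d q (beta_swap E \<beta> i j p) =
                  (4 * Gi * Gj) ^ N / (Gi - Gj)^2 *
                  (\<bar>p i * Gj - p j * Gi\<bar> / ((real N + 1) * sqrt (pi * real N)) + r N))"
proof -
  define Gi where "Gi = gibbs d E \<beta> i / (gibbs d E \<beta> i + gibbs d E \<beta> j)"
  define Gj where "Gj = gibbs d E \<beta> j / (gibbs d E \<beta> i + gibbs d E \<beta> j)"
  have g: "gibbs d E \<beta> i > 0" "gibbs d E \<beta> j > 0"
    using assms gibbs_pos by auto
  \<comment> \<open>The strict energy gap and \<open>\<beta> > 0\<close> give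
    \<open>Gj < Gi\<close>, hence \<open>Gi > 1/2\<close>, the convergence condition of the
    asymptotics.\<close>
  have "gibbs d E \<beta> j / gibbs d E \<beta> i < 1"
    using assms by (simp only: gibbs_ratio) simp
  then have "gibbs d E \<beta> j < gibbs d E \<beta> i"
    using g by simp
  then have G: "Gi > 0" "Gj > 0" "Gi + Gj = 1" "Gj < Gi"
    using g by (auto simp: Gi_def Gj_def add_divide_distrib[symmetric] divide_strict_right_mono)
  define c where "c = \<bar>p i * Gj - p j * Gi\<bar>"
  \<comment> \<open>The claimed identity solved for the remainder, so it holds for every
    \<open>N \<ge> 1\<close> by cancellation; the content is the little-o bound.\<close>
  define r where "r = (\<lambda>N. c / Gi * residual Gi Gj N * (Gi - Gj) ^ 2 / (4 * Gi * Gj) ^ N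
      - c / ((real N + 1) * sqrt (pi * real N)))"
  have r: "r \<in> o(\<lambda>N. real N powr (-3/2))"
    unfolding r_def by (rule residual_remainder) fact+
  have "\<exists>q. protocol d N E \<beta> i j (tensor N p (eta N)) = tensor N q (eta N) \<and>
      tvd d q (beta_swap E \<beta> i j p) =
        (4 * Gi * Gj) ^ N / (Gi - Gj)^2 * (c / ((real N + 1) * sqrt (pi * real N)) + r N)"
    if "N \<ge> 1" for N
  proof (intro exI conjI)
    let ?q = "marg N (Ptilde d N E \<beta> i j (tensor N p (eta N)))"
    show "protocol d N E \<beta> i j (tensor N p (eta N)) = tensor N ?q (eta N)"
      by (simp add: protocol_def mem_therm_def)
    have "tvd d ?q (beta_swap E \<beta> i j p) = c / Gi * residual Gi Gj N"
      unfolding c_def Gi_def Gj_def using assms that by (intro tvd_protocol) auto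
    also have "\<dots> = (4 * Gi * Gj) ^ N / (Gi - Gj)^2 * (c / ((real N + 1) * sqrt (pi * real N)) + r N)"
      using G by (simp add: r_def)
    finally show "tvd d ?q (beta_swap E \<beta> i j p) =
        (4 * Gi * Gj) ^ N / (Gi - Gj)^2 * (c / ((real N + 1) * sqrt (pi * real N)) + r N)" .
  qed
  with r show ?thesis
    unfolding Let_def Gi_def[symmetric] Gj_def[symmetric] c_def[symmetric] by blast
qed

end
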